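(* Let $\alpha<0$ be real. There exists $C_1(\alpha)>0$ such that for every integer $n\ge N_\alpha$ and every even $j$ with $4\le j\le n$, $$\left|\lambda_{\alpha,n,j}-\Lambda_{\alpha,n}(d_{n,j})\right|\le\frac{C_1(\alpha)}{n^3}.$$
   Context: For an integer $n\ge3$ and real $\alpha<0$, $L_{\alpha,n}$ is the real symmetric $n\times n$ matrix whose entries are: $(1,1)$ and $(n,n)$ entries equal to $1+\alpha$; $(1,n)$ and $(n,1)$ entries equal to $-\alpha$; $(k,k)$ entries equal to $2$ for $2\le k\le n-1$; $(k,k+1)$ and $(k+1,k)$ entries equal to $-1$ for $1\le k\le n-1$; all other entries $0$. Its eigenvalues, counted with multiplicity, are $\lambda_{\alpha,n,1}\le\dots\le\lambda_{\alpha,n,n}$. Put $\varkappa_\alpha=\frac{\alpha-1}{\alpha}$, $N_\alpha=\max\{3,\lfloor\varkappa_\alpha\rfloor+1\}$, $d_{n,j}=\frac{(j-1)\pi}{n}$, $g(x)=4\sin^2(x/2)$, and $\eta_\alpha(x)=2\arctan\left(\varkappa_\alpha\tan\frac{x}{2}\right)-\pi$ for $x\in[0,\pi]$ (with $\eta_\alpha(\pi)=0$ by continuity). The function $\Lambda_{\alpha,n}\colon[0,\pi]\to\mathbb{R}$ is $$\Lambda_{\alpha,n}(x)=g(x)+\frac{g'(x)\eta_\alpha(x)}{n}+\frac{g'(x)\eta_\alpha(x)\eta_\alpha'(x)+\frac12 g''(x)\eta_\alpha(x)^2}{n^2}.$$ *)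

theory Defs
  imports "HOL-Analysis.Analysis" "Jordan_Normal_Form.Char_Poly"
begin

(* Matrix indices of type mat start at 0, so the 1-based entry (i, k) sits at (i - 1, k - 1). *)
definition L_mat :: "real \<Rightarrow> nat \<Rightarrow> real mat" where
  "L_mat \<alpha> n = mat n n (\<lambda>(i, k).
     if i = k then (if i = 0 \<or> i = n - 1 then 1 + \<alpha> else 2)
     else if (i = 0 \<and> k = n - 1) \<or> (i = n - 1 \<and> k = 0) then - \<alpha>
     else if k = i + 1 \<or> i = k + 1 then - 1
     else 0)"

(* The roots of the characteristic polynomial, repeated according to multiplicity, in
   increasing order. As L_mat \<alpha> n is real symmetric, all n eigenvalues are real and
   the list has length n; eigval \<alpha> n j is meaningful for 1 \<le> j \<le> n. *)
definition eigval :: "real \<Rightarrow> nat \<Rightarrow> nat \<Rightarrow> real" where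
  "eigval \<alpha> n j = sorted_list_of_multiset (proots (char_poly (L_mat \<alpha> n))) ! (j - 1)"

definition kap :: "real \<Rightarrow> real" where
  "kap \<alpha> = (\<alpha> - 1) / \<alpha>"

definition N_min :: "real \<Rightarrow> int" where
  "N_min \<alpha> = max 3 (\<lfloor>kap \<alpha>\<rfloor> + 1)"

definition d_pt :: "nat \<Rightarrow> nat \<Rightarrow> real" where
  "d_pt n j = (real j - 1) * pi / real n"

definition g :: "real \<Rightarrow> real" where
  "g x = 4 * (sin (x / 2))\<^sup>2"

(* Only used on [0, pi]. The value at pi is the continuous extension; it has to be given
   separately because tan (pi / 2) = 0 in HOL. *)
definition eta :: "real \<Rightarrow> real \<Rightarrow> real" where
  "eta \<alpha> x = (if x = pi then 0 else 2 * arctan (kap \<alpha> * tan (x / 2)) - pi)"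

(* Derivative of eta as a function on [0, pi]: one-sided at the two end points. *)
definition eta' :: "real \<Rightarrow> real \<Rightarrow> real" where
  "eta' \<alpha> x = vector_derivative (eta \<alpha>) (at x within {0..pi})"

definition Lam :: "real \<Rightarrow> nat \<Rightarrow> real \<Rightarrow> real" where
  "Lam \<alpha> n x = g x + deriv g x * eta \<alpha> x / real n
     + (deriv g x * eta \<alpha> x * eta' \<alpha> x + 1 / 2 * deriv (deriv g) x * (eta \<alpha> x)\<^sup>2)
         / (real n)\<^sup>2"

end

theory Submission
  imports Defs
begin

text \<open>
  The matrix is the Laplacian of a cycle on \<open>n\<close> vertices in which one edge has the negative weight
  \<open>\<alpha>\<close>. An eigenvector solves a constant-coefficient recurrence of order two along the remaining
  path, with two boundary conditions imposed by the special edge, so it is a trigonometric or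
  hyperbolic function of the vertex (\<open>eigenvalue_L_mat_if_recurrence\<close>). Reversal of the path commutes
  with the matrix, and both conditions simplify on vectors that are even or odd under it.

  \<^item> Even vectors do not feel the special edge: they give the eigenvalues \<open>g (2 m \<pi> / n)\<close> of the path.
  \<^item> Odd vectors \<open>sin ((k - (n + 1) / 2) x)\<close> give \<open>g x\<close>, where
    \<open>tan (n x / 2) = \<kappa> tan (x / 2)\<close> and \<open>\<kappa> = kap \<alpha>\<close>. Taking branches of the
    arctangent turns this into \<open>n x = (j - 1) \<pi> + eta \<alpha> x\<close> with \<open>j\<close> even.
  \<^item> The branch \<open>j = 2\<close> has only the solution \<open>x = 0\<close> when \<open>n > \<kappa>\<close>, and the odd eigenvector
    missing there becomes hyperbolic; its eigenvalue is negative.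

  The angles interlace: the odd vector for even \<open>j \<ge> 4\<close> has its angle strictly between
  \<open>(j - 2) \<pi> / n\<close> and \<open>(j - 1) \<pi> / n\<close>, and the even vectors take the values \<open>(j - 1) \<pi> / n\<close>
  with \<open>j\<close> odd. Since \<open>g\<close> increases on \<open>[0, \<pi>]\<close>, this produces \<open>n\<close> distinct roots of a
  polynomial of degree \<open>n\<close>, hence the whole spectrum in increasing order; the negative eigenvalue
  comes first, the eigenvalue \<open>0\<close> of the constant vector second, and from then on the index in the
  list is \<open>j\<close> (\<open>eigval_even\<close>).

  The angle thus solves \<open>x = d + eta \<alpha> x / n\<close> with \<open>d = d_pt n j\<close>. Because \<open>eta \<alpha>\<close> and its first two
  derivatives are bounded on \<open>(0, \<pi>)\<close> uniformly, inserting the equation into itself gives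
  \<open>x - d = eta \<alpha> d / n + eta \<alpha> d * eta' \<alpha> d / n\<^sup>2 + O (n\<^sup>-\<^sup>3)\<close>, and the Taylor expansion of \<open>g\<close> at
  \<open>d\<close> then yields \<open>Lam \<alpha> n d\<close> up to \<open>O (n\<^sup>-\<^sup>3)\<close> (\<open>fixed_point_expansion\<close>).
\<close>

section \<open>Eigenvalues from solutions of the second-order recurrence\<close>

text \<open>
  The vertices carry the values \<open>f 1, \<dots>, f n\<close>; \<open>f 0\<close> and \<open>f (n + 1)\<close> are ghost values that extend
  the recurrence beyond the ends. The first and last row of the eigenvalue equation differ from
  the recurrence exactly by the two boundary conditions.
\<close>
lemma eigenvalue_L_mat_if_recurrence:
  fixes f :: "nat \<Rightarrow> real"
  assumes n: "3 \<le> n"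
    and rec: "\<And>k. f k + f (k + 2) = (2 - \<mu>) * f (k + 1)"
    and left: "f 0 = (1 - \<alpha>) * f 1 + \<alpha> * f n"
    and right: "f (n + 1) = (1 - \<alpha>) * f n + \<alpha> * f 1"
    and nz: "f 1 \<noteq> 0 \<or> f 2 \<noteq> 0"
  shows "eigenvalue (L_mat \<alpha> n) \<mu>"
proof -
  let ?L = "L_mat \<alpha> n"
  let ?v = "vec n (\<lambda>i. f (i + 1))"
  have row: "(\<Sum>k = 0..<n. ?L $$ (i, k) * f (k + 1)) = \<mu> * f (i + 1)" if i: "i < n" for i
  proof -
    consider "i = 0" | "i = n - 1" "i \<noteq> 0" | "0 < i" "i < n - 1" using i by linarith
    then show ?thesis
    proof cases
      case 1
      have "(\<Sum>k = 0..<n. ?L $$ (i, k) * f (k + 1))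
          = (\<Sum>k = 0..<n. (if k = 0 then (1 + \<alpha>) * f 1 else 0) + (if k = 1 then - f 2 else 0)
              + (if k = n - 1 then - \<alpha> * f n else 0))"
        using n 1 by (intro sum.cong) (auto simp: L_mat_def numeral_2_eq_2)
      also have "\<dots> = (1 + \<alpha>) * f 1 - f 2 - \<alpha> * f n"
        using n by (simp add: sum.distrib)
      finally show ?thesis using rec[of 0] left 1 by (simp add: algebra_simps numeral_2_eq_2)
    next
      case 2
      have "(\<Sum>k = 0..<n. ?L $$ (i, k) * f (k + 1))
          = (\<Sum>k = 0..<n. (if k = n - 1 then (1 + \<alpha>) * f n else 0)
              + (if k = n - 2 then - f (n - 1) else 0) + (if k = 0 then - \<alpha> * f 1 else 0))"
      proof (intro sum.cong refl)
        fix k assume k: "k \<in> {0..<n}"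
        consider "k = n - 1" | "k = n - 2" | "k = 0" | "k \<noteq> n - 1" "k \<noteq> n - 2" "k \<noteq> 0" by blast
        then show "?L $$ (i, k) * f (k + 1) = (if k = n - 1 then (1 + \<alpha>) * f n else 0)
              + (if k = n - 2 then - f (n - 1) else 0) + (if k = 0 then - \<alpha> * f 1 else 0)"
        proof cases
          case k2: 2
          have "n - 2 + 1 = n - 1" using n by simp
          with k2 show ?thesis using n 2 by (auto simp: L_mat_def)
        qed (use n 2 k in \<open>auto simp: L_mat_def\<close>)
      qed
      also have "\<dots> = (1 + \<alpha>) * f n - f (n - 1) - \<alpha> * f 1"
        using n by (simp add: sum.distrib)
      finally have "(\<Sum>k = 0..<n. ?L $$ (i, k) * f (k + 1)) = (1 + \<alpha>) * f n - f (n - 1) - \<alpha> * f 1" .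
      moreover have "f (n - 1) + f (n + 1) = (2 - \<mu>) * f n"
        using rec[of "n - 1"] n by (simp add: numeral_2_eq_2)
      ultimately show ?thesis using right 2 n by (simp add: algebra_simps)
    next
      case 3
      then have i': "i + 1 < n" "i - 1 < n" by linarith+
      have "(\<Sum>k = 0..<n. ?L $$ (i, k) * f (k + 1))
          = (\<Sum>k = 0..<n. (if k = i then 2 * f (i + 1) else 0) + (if k = i + 1 then - f (i + 2) else 0)
              + (if k = i - 1 then - f i else 0))"
        using n 3 by (intro sum.cong) (auto simp: L_mat_def)
      also have "\<dots> = 2 * f (i + 1) - f (i + 2) - f i"
        using i i' by (simp add: sum.distrib)
      finally show ?thesis using rec[of i] by (simp add: algebra_simps)
    qed
  qed
  have "?L *\<^sub>v ?v = \<mu> \<cdot>\<^sub>v ?v"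
    using row by (intro eq_vecI) (auto simp: L_mat_def scalar_prod_def)
  moreover have "?v \<noteq> 0\<^sub>v n"
  proof
    assume "?v = 0\<^sub>v n"
    then have "?v $ 0 = 0\<^sub>v n $ 0" "?v $ 1 = 0\<^sub>v n $ 1" by simp_all
    then show False using n nz by (simp add: numeral_2_eq_2)
  qed
  ultimately show ?thesis
    unfolding eigenvalue_def eigenvector_def by (intro exI[of _ ?v]) (auto simp: L_mat_def)
qed

text \<open>
  The cosine with half-integer shift satisfies \<open>f 0 = f 1 = f n = f (n + 1)\<close> at these angles, so the
  boundary conditions hold for every weight of the special edge.
\<close>
lemma eigenvalue_L_mat_symmetric:
  assumes n: "3 \<le> n" and x: "0 \<le> x" "x < pi" and nx: "real n * x = 2 * pi * real m"
  shows "eigenvalue (L_mat \<alpha> n) (g x)"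
proof -
  define f where "f k = cos ((real k - 1 / 2) * x)" for k
  have g: "2 - g x = 2 * cos x"
    unfolding g_def using cos_double_sin[of "x / 2"] by simp
  have rec: "f k + f (k + 2) = (2 - g x) * f (k + 1)" for k
  proof -
    have "f k = cos ((real k + 1 / 2) * x - x)" "f (k + 2) = cos ((real k + 1 / 2) * x + x)"
      "f (k + 1) = cos ((real k + 1 / 2) * x)"
      unfolding f_def by (simp_all add: algebra_simps)
    then show ?thesis unfolding g by (simp add: cos_add cos_diff)
  qed
  have per: "cos (real n * x + y) = cos y" for y
  proof -
    have "real n * x = 2 * real m * pi" using nx by simp
    then show ?thesis by (simp only: cos_add cos_2npi sin_2npi)
  qed
  have f01: "f 0 = cos (x / 2)" "f 1 = cos (x / 2)"
    unfolding f_def by (simp_all add: field_simps)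
  have fn: "f n = cos (x / 2)" "f (n + 1) = cos (x / 2)"
    using per[of "- (x / 2)"] per[of "x / 2"] unfolding f_def by (simp_all add: algebra_simps)
  have "cos (x / 2) > 0" using x by (intro cos_gt_zero_pi) auto
  then show ?thesis
    using f01 fn by (intro eigenvalue_L_mat_if_recurrence[of n f, OF n rec]) (auto simp: algebra_simps)
qed

text \<open>
  For a function that is odd about \<open>(n + 1) / 2\<close> both boundary conditions reduce to
  \<open>f 0 = (1 - 2 \<alpha>) f 1\<close>. The addition theorems turn this into
  \<open>\<alpha> sin (n x / 2) cos (x / 2) = (\<alpha> - 1) cos (n x / 2) sin (x / 2)\<close>, the cleared form of
  \<open>tan (n x / 2) = kap \<alpha> tan (x / 2)\<close>.
\<close>
lemma eigenvalue_L_mat_antisymmetric: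
  assumes n: "3 \<le> n" and \<alpha>: "\<alpha> \<noteq> 0" and x: "0 < x" "x < pi"
    and nx: "real n * x = 2 * pi * real m + 2 * arctan (kap \<alpha> * tan (x / 2))"
  shows "eigenvalue (L_mat \<alpha> n) (g x)"
proof -
  define f where "f k = sin ((real k - (real n + 1) / 2) * x)" for k
  have g: "2 - g x = 2 * cos x"
    unfolding g_def using cos_double_sin[of "x / 2"] by simp
  have rec: "f k + f (k + 2) = (2 - g x) * f (k + 1)" for k
  proof -
    define y where "y = (real k + 1 - (real n + 1) / 2) * x"
    have "f k = sin (y - x)" "f (k + 2) = sin (y + x)" "f (k + 1) = sin y"
      unfolding f_def y_def by (simp_all add: algebra_simps)
    then show ?thesis unfolding g by (simp add: sin_add sin_diff)
  qed
  define A where "A = arctan (kap \<alpha> * tan (x / 2))"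
  define S where "S = sin (real n * x / 2) * cos (x / 2)"
  define C where "C = cos (real n * x / 2) * sin (x / 2)"
  have cx: "cos (x / 2) > 0" using x by (intro cos_gt_zero_pi) auto
  have cA: "cos A > 0" unfolding A_def by (simp add: cos_arctan add_pos_nonneg)
  have half: "real n * x / 2 = A + real m * pi" using nx unfolding A_def by simp
  have "sin A = kap \<alpha> * tan (x / 2) * cos A"
    using cA tan_arctan[of "kap \<alpha> * tan (x / 2)"] unfolding A_def[symmetric]
    by (simp add: tan_def field_simps)
  then have "\<alpha> * sin A * cos (x / 2) = (\<alpha> - 1) * cos A * sin (x / 2)"
    using cx \<alpha> by (simp add: kap_def tan_def field_simps)
  then have SC: "\<alpha> * S = (\<alpha> - 1) * C"
    unfolding S_def C_def half by (simp add: sin_add cos_add sin_npi cos_npi)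
  have f0: "f 0 = - (S + C)"
  proof -
    have "f 0 = sin (- (real n * x / 2 + x / 2))"
      unfolding f_def by (rule arg_cong[of _ _ sin]) (simp add: field_simps)
    then show ?thesis unfolding S_def C_def sin_minus sin_add by simp
  qed
  have f1: "f 1 = - (S - C)"
  proof -
    have "f 1 = sin (- (real n * x / 2 - x / 2))"
      unfolding f_def by (rule arg_cong[of _ _ sin]) (simp add: field_simps)
    then show ?thesis unfolding S_def C_def sin_minus sin_diff by simp
  qed
  have odd_n: "f n = - f 1" "f (n + 1) = - f 0"
    unfolding f_def sin_minus[symmetric] by (rule arg_cong[of _ _ sin], simp add: field_simps)+
  have bc: "f 0 = (1 - 2 * \<alpha>) * f 1"
    using SC unfolding f0 f1 by (simp add: algebra_simps)
  have nz: "f 1 \<noteq> 0 \<or> f 2 \<noteq> 0"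
  proof (rule ccontr)
    define y where "y = (1 - (real n + 1) / 2) * x"
    assume "\<not> ?thesis"
    moreover have "f 1 = sin y" "f 2 = sin (y + x)" unfolding f_def y_def by (simp_all add: algebra_simps)
    ultimately have "sin y = 0" "cos y * sin x = 0" by (simp_all add: sin_add)
    moreover have "sin x > 0" using x by (rule sin_gt_zero)
    ultimately show False using sin_cos_squared_add[of y] by simp
  qed
  show ?thesis
    using odd_n bc nz by (intro eigenvalue_L_mat_if_recurrence[of n f, OF n rec]) (auto simp: algebra_simps)
qed

text \<open>
  Replacing \<open>x\<close> by an imaginary angle \<open>i s\<close> leads to the equation
  \<open>sinh ((n + 1) s / 2) = (1 - 2 \<alpha>) sinh ((n - 1) s / 2)\<close>. The difference of the two sides vanishes
  at \<open>0\<close>, where its slope \<open>\<alpha> (n - kap \<alpha>)\<close> is negative, and becomes positive for larger \<open>s\<close>, so it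
  has a positive zero.
\<close>
lemma L_mat_negative_eigenvalue:
  assumes n: "3 \<le> n" and \<alpha>: "\<alpha> < 0" and big: "kap \<alpha> < real n"
  obtains \<mu> where "\<mu> < 0" "eigenvalue (L_mat \<alpha> n) \<mu>"
proof -
  define a where "a = 1 - 2 * \<alpha>"
  define m where "m = (real n - 1) / 2"
  define H where "H s = sinh ((m + 1) * s) - a * sinh (m * s)" for s
  have a: "a > 1" and m: "m > 0" using \<alpha> n by (auto simp: a_def m_def)
  have slope: "m + 1 - a * m < 0"
    using big \<alpha> unfolding kap_def a_def m_def by (simp add: field_simps)
  have "(H has_real_derivative (m + 1 - a * m)) (at 0)"
    unfolding H_def by (auto intro!: derivative_eq_intros simp: algebra_simps)
  from DERIV_neg_dec_right[OF this slope] obtain d where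
    d: "d > 0" "\<And>h. 0 < h \<Longrightarrow> h < d \<Longrightarrow> H h < H 0" by auto
  \<comment> \<open>At \<open>cosh S = a\<close> the addition theorem cancels the terms with \<open>sinh (m S)\<close>.\<close>
  define S where "S = arcosh a"
  have S: "S > 0" "cosh S = a" using a by (auto simp: S_def)
  define b where "b = min (d / 2) S"
  have b: "b > 0" "b \<le> S" "b < d" using d S by (auto simp: b_def)
  have Hb: "H b < 0" using d(2)[OF b(1) b(3)] by (simp add: H_def)
  have "H S = cosh (m * S) * sinh S"
    using S sinh_add[of "m * S" S] unfolding H_def by (simp add: algebra_simps)
  then have HS: "H S > 0" using S by (simp add: cosh_real_pos)
  have "continuous_on {b..S} H" unfolding H_def by (intro continuous_intros)
  then obtain s where s: "b \<le> s" "H s = 0"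
    using IVT'[of H b 0 S] Hb HS b by auto
  have s0: "s > 0" using s b by simp
  define f where "f k = sinh ((real k - (real n + 1) / 2) * s)" for k
  have rec: "f k + f (k + 2) = (2 - (2 - 2 * cosh s)) * f (k + 1)" for k
  proof -
    define y where "y = (real k + 1 - (real n + 1) / 2) * s"
    have "f k = sinh (y - s)" "f (k + 2) = sinh (y + s)" "f (k + 1) = sinh y"
      unfolding f_def y_def by (simp_all add: algebra_simps)
    then show ?thesis by (simp add: sinh_add sinh_diff)
  qed
  have f1: "f 1 = - sinh (m * s)" and f0: "f 0 = - sinh ((m + 1) * s)"
    unfolding f_def m_def sinh_minus[symmetric]
    by (rule arg_cong[of _ _ sinh], simp add: field_simps)+
  have odd_n: "f n = - f 1" "f (n + 1) = - f 0"
    unfolding f_def sinh_minus[symmetric]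
    by (rule arg_cong[of _ _ sinh], simp add: field_simps)+
  have bc: "f 0 = (1 - 2 * \<alpha>) * f 1" using s(2) unfolding H_def f0 f1 a_def by simp
  have nz: "f 1 \<noteq> 0" unfolding f1 using m s0 by simp
  have "eigenvalue (L_mat \<alpha> n) (2 - 2 * cosh s)"
    using odd_n bc nz by (intro eigenvalue_L_mat_if_recurrence[of n f, OF n rec]) (auto simp: algebra_simps)
  moreover have "2 - 2 * cosh s < 0" using s0 cosh_real_strict_mono[of 0 s] by simp
  ultimately show thesis using that by blast
qed

section \<open>The ordered spectrum\<close>

text \<open>
  As many distinct roots as the degree leave no room for multiplicities or further roots.
\<close>
lemma sorted_proots_eqI:
  fixes p :: "'a :: {idom, linorder} poly"
  assumes p: "p \<noteq> 0" and xs: "sorted_wrt (<) xs" "length xs = degree p"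
    and roots: "\<And>x. x \<in> set xs \<Longrightarrow> poly p x = 0"
  shows "sorted_list_of_multiset (proots p) = xs"
proof -
  have "mset xs \<subseteq># proots p"
  proof (rule mset_subset_eqI)
    fix a
    have "count (mset xs) a = (if a \<in> set xs then 1 else 0)"
      using xs(1) by (simp add: strict_sorted_iff distinct_count_atmost_1)
    also have "\<dots> \<le> count (proots p) a" using roots[of a] p by (simp add: order_root Suc_le_eq)
    finally show "count (mset xs) a \<le> count (proots p) a" .
  qed
  moreover have "size (proots p) \<le> size (mset xs)" using xs(2) size_proots_le[of p] by simp
  ultimately have "mset xs = proots p"
    by (metis mset_subset_size not_le subset_mset.le_imp_less_or_eq)
  then show ?thesis
    using xs(1) by (metis sorted_list_of_multiset_mset sorted_sort_id strict_sorted_iff)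
qed

lemma eigval_eqI:
  assumes ev: "\<And>j. 1 \<le> j \<Longrightarrow> j \<le> n \<Longrightarrow> eigenvalue (L_mat \<alpha> n) (\<mu> j)"
    and mono: "\<And>i j. 1 \<le> i \<Longrightarrow> i < j \<Longrightarrow> j \<le> n \<Longrightarrow> \<mu> i < \<mu> j"
    and j: "1 \<le> j" "j \<le> n"
  shows "eigval \<alpha> n j = \<mu> j"
proof -
  let ?L = "L_mat \<alpha> n"
  have L: "?L \<in> carrier_mat n n" by (simp add: L_mat_def)
  have "sorted_list_of_multiset (proots (char_poly ?L)) = map \<mu> [1..<Suc n]"
  proof (rule sorted_proots_eqI)
    show "char_poly ?L \<noteq> 0" using degree_monic_char_poly[OF L] by auto
    show "sorted_wrt (<) (map \<mu> [1..<Suc n])"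
      unfolding sorted_wrt_map by (rule sorted_wrt_mono_rel[OF _ sorted_wrt_upt]) (auto intro: mono)
    show "length (map \<mu> [1..<Suc n]) = degree (char_poly ?L)"
      using degree_monic_char_poly[OF L] by simp
  qed (use ev eigenvalue_root_char_poly[OF L] in auto)
  then show ?thesis using j by (simp add: eigval_def del: upt_Suc)
qed

text \<open>
  Between the two bounds \<open>n x - (j - 2) \<pi>\<close> grows from \<open>0\<close> to \<open>\<pi>\<close>, whereas
  \<open>2 arctan (kap \<alpha> tan (x / 2))\<close> stays strictly between \<open>0\<close> and \<open>\<pi>\<close>; hence they cross. For
  \<open>j = 2\<close> the lower bound would be \<open>0\<close>, where both vanish.
\<close>
lemma antisymmetric_angle_exists:
  assumes \<alpha>: "\<alpha> < 0" and j: "even j" "4 \<le> j" "j \<le> n"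
  shows "\<exists>x. (real j - 2) * pi / real n < x \<and> x < d_pt n j
    \<and> real n * x = (real j - 1) * pi + eta \<alpha> x"
proof -
  let ?l = "(real j - 2) * pi / real n" and ?r = "d_pt n j"
  define F where "F x = real n * x - (real j - 2) * pi - 2 * arctan (kap \<alpha> * tan (x / 2))" for x
  have k: "kap \<alpha> > 0" using \<alpha> by (simp add: kap_def zero_less_divide_iff)
  have n: "n > 0" using j by simp
  have l: "0 < ?l" using j by simp
  have lr: "?l < ?r" unfolding d_pt_def using n by (simp add: divide_strict_right_mono)
  have "(real j - 1) * pi < real n * pi" using j by (intro mult_strict_right_mono) auto
  then have r: "?r < pi" unfolding d_pt_def using n by (simp add: field_simps)
  have cos: "cos (x / 2) \<noteq> 0" if "?l \<le> x" "x \<le> ?r" for x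
    using cos_gt_zero_pi[of "x / 2"] that l r by auto
  have "tan (?l / 2) > 0"
    using tan_gt_zero[OF half_gt_zero[OF l] divide_strict_right_mono[OF less_trans[OF lr r]]] by simp
  then have Fl: "F ?l < 0" unfolding F_def using n k by simp
  have "real n * ?r = (real j - 1) * pi" using n by (simp add: d_pt_def)
  then have "F ?r = pi - 2 * arctan (kap \<alpha> * tan (?r / 2))"
    unfolding F_def by (simp add: algebra_simps)
  then have Fr: "F ?r > 0" using arctan_ubound[of "kap \<alpha> * tan (?r / 2)"] by simp
  have "continuous_on {?l..?r} F" unfolding F_def using cos by (intro continuous_intros) auto
  then obtain x where x: "?l \<le> x" "x \<le> ?r" "F x = 0"
    using IVT'[of F ?l 0 ?r] Fl Fr lr by auto
  then have "x \<noteq> ?l" "x \<noteq> ?r" using Fl Fr by auto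
  moreover have "real n * x = (real j - 1) * pi + eta \<alpha> x"
    using x r unfolding F_def eta_def by (simp add: algebra_simps)
  ultimately show ?thesis using x by (intro exI[of _ x]) auto
qed

lemma g_strict_mono: "0 \<le> x \<Longrightarrow> x < y \<Longrightarrow> y \<le> pi \<Longrightarrow> g x < g y"
  using cos_monotone_0_pi[of x y] cos_double_sin[of "x / 2"] cos_double_sin[of "y / 2"]
  unfolding g_def by simp

text \<open>
  The angles \<open>\<phi> i\<close> for \<open>i \<ge> 2\<close> come alternately from odd and even vectors, with \<open>\<phi> 2 = 0\<close> from the
  constant vector. They increase because \<open>\<phi> i\<close> lies in
  \<open>[(i - 2) \<pi> / n, (i - 1) \<pi> / n]\<close>, and of two neighbours at most the one with an odd index touches
  the common end point. Index \<open>1\<close> belongs to the negative eigenvalue.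
\<close>
lemma eigval_even:
  assumes \<alpha>: "\<alpha> < 0" and n: "3 \<le> n" and big: "kap \<alpha> < real n"
    and j: "even j" "4 \<le> j" "j \<le> n"
  obtains x where "0 < x" "x < pi" "real n * x = (real j - 1) * pi + eta \<alpha> x"
    "eigval \<alpha> n j = g x"
proof -
  obtain \<nu> where \<nu>: "\<nu> < 0" "eigenvalue (L_mat \<alpha> n) \<nu>"
    by (rule L_mat_negative_eigenvalue[OF n \<alpha> big])
  obtain \<psi> where \<psi>_all: "\<forall>i. even i \<and> 4 \<le> i \<and> i \<le> n \<longrightarrow> (real i - 2) * pi / real n < \<psi> i
      \<and> \<psi> i < d_pt n i \<and> real n * \<psi> i = (real i - 1) * pi + eta \<alpha> (\<psi> i)"
    using antisymmetric_angle_exists[OF \<alpha>, of _ n] by (atomize_elim, intro choice) blast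
  then have \<psi>: "(real i - 2) * pi / real n < \<psi> i" "\<psi> i < d_pt n i"
      "real n * \<psi> i = (real i - 1) * pi + eta \<alpha> (\<psi> i)"
    if "even i" "4 \<le> i" "i \<le> n" for i
    using that by blast+
  define \<phi> where "\<phi> i = (if odd i then d_pt n i else if i = 2 then 0 else \<psi> i)" for i
  have d: "d_pt n i < pi" if "i \<le> n" for i
  proof -
    have "(real i - 1) * pi < real n * pi" using that by (intro mult_strict_right_mono) auto
    then show ?thesis unfolding d_pt_def using n by (simp add: field_simps)
  qed
  have step: "d_pt n i \<le> (real k - 2) * pi / real n" if "i < k" for i k
    unfolding d_pt_def using that by (intro divide_right_mono mult_right_mono) auto
  have even4: "4 \<le> i" if "even i" "2 \<le> i" "i \<noteq> 2" for i :: nat using that by presburger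
  have \<phi>_le: "\<phi> i \<le> d_pt n i" "odd i \<or> \<phi> i < d_pt n i" if i: "2 \<le> i" "i \<le> n" for i
    using \<psi>(2)[of i] even4[of i] i n by (auto simp: \<phi>_def d_pt_def)
  have "(real i - 2) * pi / real n < d_pt n i" for i
    unfolding d_pt_def using n by (intro divide_strict_right_mono mult_strict_right_mono) auto
  then have \<phi>_ge: "(real i - 2) * pi / real n \<le> \<phi> i" "i = 2 \<or> (real i - 2) * pi / real n < \<phi> i"
    if i: "2 \<le> i" "i \<le> n" for i
    using \<psi>(1)[of i] even4[of i] i by (auto simp: \<phi>_def intro: less_imp_le)
  have \<phi>_nonneg: "0 \<le> \<phi> i" if "2 \<le> i" "i \<le> n" for i
    using order_trans[OF _ \<phi>_ge(1)[OF that], of 0] that by simp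
  have \<phi>_pi: "\<phi> i < pi" if "2 \<le> i" "i \<le> n" for i using \<phi>_le(1)[OF that] d[of i] that by simp
  have \<phi>_mono: "\<phi> i < \<phi> k" if "2 \<le> i" "i < k" "k \<le> n" for i k
    using \<phi>_le(1)[of i] \<phi>_ge(2)[of k] step[of i k] that by auto
  define \<mu> where "\<mu> i = (if i = 1 then \<nu> else g (\<phi> i))" for i
  have "eigval \<alpha> n j = \<mu> j"
  proof (rule eigval_eqI)
    fix i assume i: "1 \<le> i" "i \<le> n"
    consider "i = 1" | "i \<noteq> 1" "odd i" | "i = 2" | "even i" "i \<noteq> 2" by blast
    then show "eigenvalue (L_mat \<alpha> n) (\<mu> i)"
    proof cases
      case 1 then show ?thesis using \<nu> by (simp add: \<mu>_def)
    next
      case 2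
      then have "2 \<le> i" using i by simp
      from 2 obtain m where m: "i = 2 * m + 1" by (auto elim: oddE)
      have "real n * \<phi> i = 2 * pi * real m"
        using 2 n m by (simp add: \<phi>_def d_pt_def)
      then show ?thesis
        using eigenvalue_L_mat_symmetric[OF n \<phi>_nonneg[OF \<open>2 \<le> i\<close> i(2)] \<phi>_pi[OF \<open>2 \<le> i\<close> i(2)]] 2
        by (simp add: \<mu>_def)
    next
      case 3
      then show ?thesis
        using eigenvalue_L_mat_symmetric[OF n, of 0 0] by (simp add: \<mu>_def \<phi>_def)
    next
      case 4
      then have i4: "2 \<le> i" "4 \<le> i" using i even4[of i] by presburger+
      from 4(1) obtain m where m: "i = 2 * m" by (auto elim: evenE)
      have pos: "0 < \<phi> i" using \<phi>_mono[of 2 i] \<phi>_nonneg[of 2] i4 i by simp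
      \<comment> \<open>The \<open>- pi\<close> inside \<open>eta\<close> lowers the odd multiple \<open>i - 1\<close> of \<open>pi\<close> to \<open>2 (m - 1)\<close>.\<close>
      have "real n * \<phi> i = 2 * pi * real (m - 1) + 2 * arctan (kap \<alpha> * tan (\<phi> i / 2))"
        using \<psi>(3)[of i] 4 i i4 m \<phi>_pi[of i] by (simp add: \<phi>_def eta_def of_nat_diff algebra_simps)
      then show ?thesis
        using eigenvalue_L_mat_antisymmetric[OF n _ pos \<phi>_pi[OF i4(1) i(2)]] 4 i \<alpha>
        by (auto simp: \<mu>_def)
    qed
  next
    fix i k assume ik: "1 \<le> i" "i < k" "k \<le> n"
    show "\<mu> i < \<mu> k"
    proof (cases "i = 1")
      case True
      have "g (\<phi> k) \<ge> 0" by (simp add: g_def)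
      then show ?thesis using True ik \<nu> by (simp add: \<mu>_def)
    next
      case False
      then show ?thesis
        using g_strict_mono[OF \<phi>_nonneg[of i] \<phi>_mono[of i k]] \<phi>_pi[of k] ik by (simp add: \<mu>_def)
    qed
  qed (use j in auto)
  moreover have "\<phi> j = \<psi> j" using j by (simp add: \<phi>_def)
  ultimately have "eigval \<alpha> n j = g (\<psi> j)" using j by (simp add: \<mu>_def)
  moreover have "0 < \<psi> j" using \<phi>_mono[of 2 j] \<phi>_nonneg[of 2] j \<open>\<phi> j = \<psi> j\<close> by simp
  moreover have "\<psi> j < pi" using \<psi>(2)[OF j] d[of j] j by simp
  ultimately show thesis using that \<psi>(3)[OF j] by blast
qed

section \<open>Taylor expansion of the eigenvalues\<close>

lemma second_order_taylor_bound:
  fixes f f1 f2 :: "real \<Rightarrow> real"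
  assumes f: "\<And>t. t \<in> {a<..<b} \<Longrightarrow> (f has_real_derivative f1 t) (at t)"
    and f1: "\<And>t. t \<in> {a<..<b} \<Longrightarrow> (f1 has_real_derivative f2 t) (at t)"
    and f2: "\<And>t. t \<in> {a<..<b} \<Longrightarrow> \<bar>f2 t\<bar> \<le> M"
    and cx: "c \<in> {a<..<b}" "x \<in> {a<..<b}"
  shows "\<bar>f x - f c - f1 c * (x - c)\<bar> \<le> M / 2 * (x - c)\<^sup>2"
proof (cases "x = c")
  case False
  have "\<exists>t. (if x < c then x < t \<and> t < c else c < t \<and> t < x)
      \<and> f x = (\<Sum>m<2. ((\<lambda>m. [f, f1, f2] ! m) m c / fact m) * (x - c) ^ m)
        + ((\<lambda>m. [f, f1, f2] ! m) 2 t / fact 2) * (x - c) ^ 2"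
    by (rule Taylor[where a = "min x c" and b = "max x c"])
      (use False cx in \<open>auto simp: less_2_cases_iff min_le_iff_disj le_max_iff_disj intro!: f f1\<close>)
  then obtain t where t: "if x < c then x < t \<and> t < c else c < t \<and> t < x"
    "f x = f c + f1 c * (x - c) + f2 t / 2 * (x - c)\<^sup>2"
    by (auto simp: eval_nat_numeral)
  have "\<bar>f2 t\<bar> \<le> M" using t(1) cx by (intro f2) (auto split: if_splits)
  then have "\<bar>f2 t / 2 * (x - c)\<^sup>2\<bar> \<le> M / 2 * (x - c)\<^sup>2"
    unfolding abs_mult by (intro mult_mono) auto
  then show ?thesis using t(2) by simp
qed simp

text \<open>
  Since \<open>g x = 2 - 2 cos x\<close>, the coefficients are \<open>g' c = 2 sin c\<close> and \<open>g'' c / 2 = cos c\<close>, and the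
  third derivative is at most \<open>2\<close> in absolute value.
\<close>
lemma third_order_taylor_bound_g:
  "\<bar>g x - g c - 2 * sin c * (x - c) - cos c * (x - c)\<^sup>2\<bar> \<le> \<bar>x - c\<bar> ^ 3"
proof (cases "x = c")
  case False
  have g: "g y = 2 - 2 * cos y" for y
    using cos_double_sin[of "y / 2"] unfolding g_def by simp
  let ?D = "\<lambda>m. [\<lambda>y. - cos y, sin, cos, \<lambda>y. - sin y :: real] ! m"
  have "\<exists>t. (if x < c then x < t \<and> t < c else c < t \<and> t < x)
      \<and> - cos x = (\<Sum>m<3. (?D m c / fact m) * (x - c) ^ m) + (?D 3 t / fact 3) * (x - c) ^ 3"
    by (rule Taylor[where a = "min x c" and b = "max x c"])
      (use False in \<open>auto simp: less_Suc_eq eval_nat_numeral intro!: derivative_eq_intros\<close>)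
  then obtain t where "- cos x = - cos c + sin c * (x - c) + cos c / 2 * (x - c)\<^sup>2
      - sin t / 6 * (x - c) ^ 3"
    by (auto simp: eval_nat_numeral)
  then have "g x - g c - 2 * sin c * (x - c) - cos c * (x - c)\<^sup>2 = - (sin t / 3) * (x - c) ^ 3"
    unfolding g by simp
  moreover have "\<bar>- (sin t / 3) * (x - c) ^ 3\<bar> \<le> 1 * \<bar>x - c\<bar> ^ 3"
    unfolding abs_mult power_abs using abs_sin_le_one[of t]
    by (intro mult_right_mono) (simp_all del: abs_sin_le_one)
  ultimately show ?thesis by simp
qed simp

lemma deriv_g: "deriv g = (\<lambda>x. 2 * sin x)" and deriv2_g: "deriv (deriv g) = (\<lambda>x. 2 * cos x)"
proof -
  have "(g has_real_derivative 2 * sin x) (at x)" for x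
    unfolding g_def using sin_double[of "x / 2"]
    by (auto intro!: derivative_eq_intros)
  then show *: "deriv g = (\<lambda>x. 2 * sin x)" by (auto intro: DERIV_imp_deriv)
  show "deriv (deriv g) = (\<lambda>x. 2 * cos x)"
    unfolding * by (auto intro!: ext DERIV_imp_deriv derivative_eq_intros)
qed

text \<open>
  The derivative of \<open>eta\<close>, with \<open>k\<close> for \<open>kap \<alpha>\<close>. In this form the tangent has disappeared, and the
  denominator is at least \<open>1\<close> for \<open>k \<ge> 1\<close>, which makes the bounds below uniform up to \<open>0\<close> and \<open>\<pi>\<close>.
\<close>
definition eta_slope :: "real \<Rightarrow> real \<Rightarrow> real" where
  "eta_slope k x = k / (1 + (k\<^sup>2 - 1) * (sin (x / 2))\<^sup>2)"

lemma eta_has_derivative: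
  assumes x: "0 < x" "x < pi"
  shows "(eta \<alpha> has_real_derivative eta_slope (kap \<alpha>) x) (at x)"
proof -
  let ?k = "kap \<alpha>"
  have c: "cos (x / 2) > 0" using x by (intro cos_gt_zero_pi) auto
  define t where "t = tan (x / 2)"
  have sin: "sin (x / 2) = cos (x / 2) * t" using c by (simp add: t_def tan_def)
  have expand: "(cos (x / 2))\<^sup>2 * (1 + (?k * t)\<^sup>2) = (cos (x / 2))\<^sup>2 + ?k\<^sup>2 * (sin (x / 2))\<^sup>2"
    unfolding sin by (simp add: power2_eq_square algebra_simps)
  have denom: "(cos (x / 2))\<^sup>2 * (1 + (?k * t)\<^sup>2) = 1 + (?k\<^sup>2 - 1) * (sin (x / 2))\<^sup>2"
    unfolding expand left_diff_distrib using sin_cos_squared_add[of "x / 2"] by linarith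
  have "((\<lambda>x. x / 2) has_real_derivative 1 / 2) (at x)"
    by (auto intro!: derivative_eq_intros)
  from DERIV_chain2[OF DERIV_tan this] c
  have tan: "((\<lambda>x. tan (x / 2)) has_real_derivative inverse ((cos (x / 2))\<^sup>2) * (1 / 2)) (at x)"
    by simp
  note DERIV_diff[OF DERIV_cmult[OF DERIV_chain2[OF DERIV_arctan DERIV_cmult[OF tan, of ?k]], of 2]
      DERIV_const[of pi]]
  moreover have "2 * (inverse (1 + (?k * tan (x / 2))\<^sup>2) * (?k * (inverse ((cos (x / 2))\<^sup>2) * (1 / 2)))) - 0
      = ?k / ((cos (x / 2))\<^sup>2 * (1 + (?k * tan (x / 2))\<^sup>2))"
    unfolding divide_inverse inverse_mult_distrib by (simp only: ac_simps diff_0_right) simp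
  ultimately have "((\<lambda>x. 2 * arctan (?k * tan (x / 2)) - pi) has_real_derivative eta_slope ?k x) (at x)"
    unfolding eta_slope_def denom[symmetric] t_def by (simp only:)
  then show ?thesis
    by (rule has_field_derivative_transform_within_open[of _ _ _ "{..<pi}"])
      (use x in \<open>auto simp: eta_def\<close>)
qed

lemma eta'_eq: "0 < x \<Longrightarrow> x < pi \<Longrightarrow> eta' \<alpha> x = eta_slope (kap \<alpha>) x"
  unfolding eta'_def using eta_has_derivative[of x \<alpha>]
  by (intro vector_derivative_at_within_ivl)
    (auto simp: has_real_derivative_iff_has_vector_derivative)

lemma abs_eta_le_pi:
  assumes "\<alpha> < 0" "0 < x" "x < pi"
  shows "\<bar>eta \<alpha> x\<bar> \<le> pi"
proof -
  have "kap \<alpha> > 0" using assms by (simp add: kap_def zero_less_divide_iff)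
  moreover have "tan (x / 2) > 0" using assms by (intro tan_gt_zero) auto
  ultimately have "arctan (kap \<alpha> * tan (x / 2)) > 0" by simp
  then show ?thesis using arctan_ubound[of "kap \<alpha> * tan (x / 2)"] assms by (simp add: eta_def)
qed

lemma eta_slope_denominator:
  assumes "1 \<le> k"
  shows "1 \<le> 1 + (k\<^sup>2 - 1) * (sin (y :: real))\<^sup>2"
  using assms by (simp add: zero_le_mult_iff)

lemma eta_slope_bounds:
  assumes k: "1 \<le> k"
  shows "0 \<le> eta_slope k x" "eta_slope k x \<le> k"
proof -
  show "0 \<le> eta_slope k x" "eta_slope k x \<le> k"
    unfolding eta_slope_def using eta_slope_denominator[OF k, of "x / 2"] k
    by (auto simp: divide_le_eq)
qed

text \<open>The second derivative of \<open>eta\<close>.\<close>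
definition eta_curvature :: "real \<Rightarrow> real \<Rightarrow> real" where
  "eta_curvature k x = - (k * (k\<^sup>2 - 1) * sin (x / 2) * cos (x / 2))
     / (1 + (k\<^sup>2 - 1) * (sin (x / 2))\<^sup>2)\<^sup>2"

lemma eta_slope_has_derivative:
  assumes k: "1 \<le> k"
  shows "(eta_slope k has_real_derivative eta_curvature k x) (at x)"
proof -
  have "1 + (k\<^sup>2 - 1) * (sin (x / 2))\<^sup>2 \<noteq> 0" using eta_slope_denominator[OF k, of "x / 2"] by linarith
  then show ?thesis
    unfolding eta_slope_def eta_curvature_def
    by (auto intro!: derivative_eq_intros simp: power2_eq_square)
qed

lemma abs_eta_curvature_le:
  assumes k: "1 \<le> k"
  shows "\<bar>eta_curvature k x\<bar> \<le> k ^ 3"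
proof -
  let ?D = "1 + (k\<^sup>2 - 1) * (sin (x / 2))\<^sup>2"
  have "?D\<^sup>2 \<ge> 1" using eta_slope_denominator[OF k, of "x / 2"] by (simp add: one_le_power)
  have k2: "k\<^sup>2 \<ge> 1" using k by (simp add: one_le_power)
  have "\<bar>sin (x / 2)\<bar> * \<bar>cos (x / 2)\<bar> \<le> 1 * 1" by (intro mult_mono) auto
  then have "k * (k\<^sup>2 - 1) * (\<bar>sin (x / 2)\<bar> * \<bar>cos (x / 2)\<bar>) \<le> k * (k\<^sup>2 - 1) * 1"
    using k k2 by (intro mult_left_mono) auto
  also have "\<dots> \<le> k ^ 3" using k by (simp add: algebra_simps power3_eq_cube power2_eq_square)
  finally have num: "k * (k\<^sup>2 - 1) * (\<bar>sin (x / 2)\<bar> * \<bar>cos (x / 2)\<bar>) \<le> k ^ 3" .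
  have "\<bar>eta_curvature k x\<bar> = k * (k\<^sup>2 - 1) * (\<bar>sin (x / 2)\<bar> * \<bar>cos (x / 2)\<bar>) / ?D\<^sup>2"
    unfolding eta_curvature_def using k k2 by (simp add: abs_mult)
  also have "\<dots> \<le> k ^ 3 / 1" using num k \<open>?D\<^sup>2 \<ge> 1\<close> by (intro frac_le) auto
  finally show ?thesis by simp
qed

text \<open>
  The quantitative core, freed from the functions involved: \<open>N\<close> stands for the size of the matrix,
  \<open>h\<close> and \<open>h0\<close> for \<open>eta\<close> at \<open>x\<close> and at \<open>d\<close>, so that \<open>h / N = x - d\<close>; \<open>e\<close> for \<open>eta'\<close> at \<open>d\<close>;
  \<open>g1\<close> and \<open>g2\<close> for the first two Taylor coefficients of \<open>g\<close> at \<open>d\<close>; \<open>r\<close> and \<open>R\<close> for the Taylor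
  remainders of \<open>eta\<close> and \<open>g\<close>. Replacing \<open>h\<close> by \<open>h0\<close> costs \<open>q / N\<close> with \<open>q\<close> bounded by \<open>K\<close>,
  and doing so a second time inside \<open>q\<close> produces the term with \<open>e\<close>. What is left is a sum of four
  bounded quantities divided by \<open>N\<^sup>3\<close>.
\<close>
lemma fixed_point_expansion:
  fixes N h h0 e r R g1 g2 k M :: real
  assumes N: "1 \<le> N" and k: "0 \<le> k" and M: "0 \<le> M"
    and h: "h = h0 + e * (h / N) + r"
    and bounds: "\<bar>h\<bar> \<le> pi" "\<bar>h0\<bar> \<le> pi" "\<bar>e\<bar> \<le> k" "\<bar>g1\<bar> \<le> 2" "\<bar>g2\<bar> \<le> 1"
    and r: "\<bar>r\<bar> \<le> M * (h / N)\<^sup>2" and R: "\<bar>R\<bar> \<le> \<bar>h / N\<bar> ^ 3"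
  defines "K \<equiv> k * pi + M * pi\<^sup>2"
  shows "\<bar>g1 * (h / N) + g2 * (h / N)\<^sup>2 + R - (g1 * h0 / N + (g1 * h0 * e + g2 * h0\<^sup>2) / N\<^sup>2)\<bar>
    \<le> (2 * k * K + 2 * M * pi\<^sup>2 + 2 * pi * K + pi ^ 3) / N ^ 3"
proof -
  have h2: "h\<^sup>2 \<le> pi\<^sup>2" using power_mono[OF bounds(1) abs_ge_zero, of 2] by simp
  \<comment> \<open>\<open>\<rho>\<close> and, below, \<open>R3\<close> are the remainders rescaled by their order, hence bounded.\<close>
  define \<rho> where "\<rho> = r * N\<^sup>2"
  have "\<bar>\<rho>\<bar> \<le> M * h\<^sup>2"
    using r N unfolding \<rho>_def by (simp add: abs_mult power_divide field_simps)
  also have "\<dots> \<le> M * pi\<^sup>2" using h2 M by (rule mult_left_mono)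
  finally have \<rho>: "\<bar>\<rho>\<bar> \<le> M * pi\<^sup>2" .
  define q where "q = e * h + \<rho> / N"
  have "\<bar>e * h\<bar> \<le> k * pi" unfolding abs_mult using bounds k by (intro mult_mono) auto
  moreover have "\<bar>\<rho> / N\<bar> \<le> M * pi\<^sup>2"
  proof -
    have "\<bar>\<rho>\<bar> / N \<le> \<bar>\<rho>\<bar> / 1" using N by (intro divide_left_mono) auto
    then show ?thesis using \<rho> N by (simp add: abs_divide)
  qed
  ultimately have q: "\<bar>q\<bar> \<le> K" unfolding q_def K_def by linarith
  have K0: "0 \<le> K" using q by linarith
  have hq: "h - h0 = q / N"
    using h N unfolding q_def \<rho>_def by (simp add: field_simps power2_eq_square)
  define R3 where "R3 = R * N ^ 3"
  have "\<bar>R3\<bar> \<le> \<bar>h\<bar> ^ 3"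
    using R N unfolding R3_def by (simp add: abs_mult abs_divide power_divide field_simps)
  also have "\<dots> \<le> pi ^ 3" using bounds(1) by (intro power_mono) auto
  finally have R3: "\<bar>R3\<bar> \<le> pi ^ 3" .
  have t1: "\<bar>g1 * e * q\<bar> \<le> 2 * k * K"
    unfolding abs_mult using bounds q k by (intro mult_mono) auto
  have t2: "\<bar>g1 * \<rho>\<bar> \<le> 2 * (M * pi\<^sup>2)"
    unfolding abs_mult using bounds \<rho> by (intro mult_mono) auto
  have t3: "\<bar>g2 * (q * (h + h0))\<bar> \<le> 1 * (K * (2 * pi))"
    unfolding abs_mult using bounds q K0 by (intro mult_mono) auto
  have "g1 * (h / N) + g2 * (h / N)\<^sup>2 + R - (g1 * h0 / N + (g1 * h0 * e + g2 * h0\<^sup>2) / N\<^sup>2)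
      = g1 * ((h - h0) / N) - g1 * h0 * e / N\<^sup>2 + g2 * ((h - h0) * (h + h0)) / N\<^sup>2 + R"
    using N by (simp add: field_simps power2_eq_square)
  also have "\<dots> = g1 * (q - e * h0) / N\<^sup>2 + g2 * (q / N * (h + h0)) / N\<^sup>2 + R"
    unfolding hq using N by (simp add: field_simps power2_eq_square)
  also have "q - e * h0 = e * (h - h0) + \<rho> / N" unfolding q_def by (simp add: algebra_simps)
  also have "g1 * (e * (h - h0) + \<rho> / N) / N\<^sup>2 + g2 * (q / N * (h + h0)) / N\<^sup>2 + R
      = (g1 * e * q + g1 * \<rho> + g2 * (q * (h + h0)) + R3) / N ^ 3"
    unfolding hq R3_def using N by (simp add: field_simps power2_eq_square power3_eq_cube)
  finally have eq: "g1 * (h / N) + g2 * (h / N)\<^sup>2 + R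
        - (g1 * h0 / N + (g1 * h0 * e + g2 * h0\<^sup>2) / N\<^sup>2)
      = (g1 * e * q + g1 * \<rho> + g2 * (q * (h + h0)) + R3) / N ^ 3" .
  have "\<bar>g1 * e * q + g1 * \<rho> + g2 * (q * (h + h0)) + R3\<bar>
      \<le> 2 * k * K + 2 * M * pi\<^sup>2 + 2 * pi * K + pi ^ 3"
    using t1 t2 t3 R3 by (simp add: algebra_simps)
  then show ?thesis unfolding eq abs_divide using N by (simp add: divide_right_mono)
qed

theorem theorem2p3:
  fixes \<alpha> :: real
  assumes "\<alpha> < 0"
  shows "\<exists>C1 > 0. \<forall>n j :: nat. int n \<ge> N_min \<alpha> \<longrightarrow> even j \<longrightarrow> 4 \<le> j \<longrightarrow> j \<le> n \<longrightarrow>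
           \<bar>eigval \<alpha> n j - Lam \<alpha> n (d_pt n j)\<bar> \<le> C1 / real n ^ 3"
proof -
  define k where "k = kap \<alpha>"
  have k: "1 \<le> k" using assms unfolding k_def kap_def by (simp add: field_simps)
  define M where "M = k ^ 3 / 2"
  define K where "K = k * pi + M * pi\<^sup>2"
  define C where "C = 2 * k * K + 2 * M * pi\<^sup>2 + 2 * pi * K + pi ^ 3"
  have M: "0 \<le> M" using k by (simp add: M_def)
  have K: "0 \<le> K" using k M by (simp add: K_def)
  have "0 < pi ^ 3" "0 \<le> 2 * k * K" "0 \<le> 2 * M * pi\<^sup>2" "0 \<le> 2 * pi * K"
    using k M K by simp_all
  then have "C > 0" unfolding C_def by linarith
  moreover have "\<bar>eigval \<alpha> n j - Lam \<alpha> n (d_pt n j)\<bar> \<le> C / real n ^ 3"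
    if nN: "int n \<ge> N_min \<alpha>" and j: "even j" "4 \<le> j" "j \<le> n" for n j
  proof -
    have n: "3 \<le> n" and "\<lfloor>kap \<alpha>\<rfloor> < int n" using nN by (auto simp: N_min_def)
    then have big: "kap \<alpha> < real n" by (simp add: floor_less_iff)
    obtain x where x: "0 < x" "x < pi" "real n * x = (real j - 1) * pi + eta \<alpha> x"
      "eigval \<alpha> n j = g x"
      by (rule eigval_even[OF assms n big j])
    let ?d = "d_pt n j"
    have "(real j - 1) * pi < real n * pi" using j by (intro mult_strict_right_mono) auto
    then have d: "0 < ?d" "?d < pi" unfolding d_pt_def using n j by (simp_all add: field_simps)
    have xd: "x - ?d = eta \<alpha> x / real n" unfolding d_pt_def using x(3) n by (simp add: field_simps)
    define r where "r = eta \<alpha> x - eta \<alpha> ?d - eta_slope k ?d * (x - ?d)"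
    define R where "R = g x - g ?d - 2 * sin ?d * (x - ?d) - cos ?d * (x - ?d)\<^sup>2"
    have r: "\<bar>r\<bar> \<le> M * (x - ?d)\<^sup>2"
      unfolding r_def M_def k_def
      by (rule second_order_taylor_bound[where a = 0 and b = pi and ?f2.0 = "eta_curvature (kap \<alpha>)"])
        (use d x k in \<open>auto simp: k_def intro!: eta_has_derivative eta_slope_has_derivative abs_eta_curvature_le\<close>)
    have R: "\<bar>R\<bar> \<le> \<bar>x - ?d\<bar> ^ 3" unfolding R_def by (rule third_order_taylor_bound_g)
    have "\<bar>2 * sin ?d * (eta \<alpha> x / real n) + cos ?d * (eta \<alpha> x / real n)\<^sup>2 + R
        - (2 * sin ?d * eta \<alpha> ?d / real n
          + (2 * sin ?d * eta \<alpha> ?d * eta_slope k ?d + cos ?d * (eta \<alpha> ?d)\<^sup>2) / (real n)\<^sup>2)\<bar>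
        \<le> C / real n ^ 3"
      unfolding C_def K_def
    proof (rule fixed_point_expansion)
      show "eta \<alpha> x = eta \<alpha> ?d + eta_slope k ?d * (eta \<alpha> x / real n) + r"
        unfolding r_def xd by simp
      show "\<bar>eta_slope k ?d\<bar> \<le> k" using eta_slope_bounds[OF k] by simp
      show "\<bar>2 * sin ?d\<bar> \<le> 2" by (simp add: abs_mult)
    qed (use n k M assms x d r R xd in \<open>auto intro: abs_eta_le_pi\<close>)
    moreover have "eigval \<alpha> n j - Lam \<alpha> n ?d
        = 2 * sin ?d * (eta \<alpha> x / real n) + cos ?d * (eta \<alpha> x / real n)\<^sup>2 + R
        - (2 * sin ?d * eta \<alpha> ?d / real n
          + (2 * sin ?d * eta \<alpha> ?d * eta_slope k ?d + cos ?d * (eta \<alpha> ?d)\<^sup>2) / (real n)\<^sup>2)"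
      unfolding x(4) Lam_def deriv2_g
      unfolding deriv_g eta'_eq[OF d] R_def xd k_def by (simp add: algebra_simps)
    ultimately show ?thesis by simp
  qed
  ultimately show ?thesis by blast
qed

end
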